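(* Let $G$ be a homocyclic group of exponent $\exp(G)\in\{2,3,4\}$ (that is, $G\cong C_m^n$ with $m\in\{2,3,4\}$ and $n\ge 1$), and let $n:=\operatorname{rk} G$. If $A\subseteq G$ is non-empty and $\partial_S(A)\le(1-\gamma)n|A|$ for some generating subset $S\subseteq G$ and some real $\gamma\in(0,1]$, then $$|A|\ge |G|^{\gamma}.$$
   Context: For finite subsets $A,S$ of an abelian group $G$, $\partial_S(A)$ denotes the number of edges from $A$ to its complement in the directed Cayley graph induced on $G$ by $S$, i.e. $\partial_S(A)=|\{(a,s)\in A\times S: a+s\notin A\}|$. $C_m$ denotes the cyclic group of order $m$. *)

theory Defs
  imports "HOL-Algebra.Algebra" Complex_Main
begin

text \<open>The abelian groups are written multiplicatively, following HOL-Algebra.\<close>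

definition cyclic_power :: "nat \<Rightarrow> nat \<Rightarrow> (nat \<Rightarrow> int) monoid" where
  "cyclic_power m n = product_group {..<n} (\<lambda>_. integer_mod_group m)"

text \<open>Since \<open>integer_mod_group 0\<close> is the infinite cyclic group, the condition \<open>1 \<le> m\<close>
  restricts to finite groups.\<close>

definition homocyclic :: "('a, 'b) monoid_scheme \<Rightarrow> bool" where
  "homocyclic G \<longleftrightarrow> comm_group G \<and> (\<exists>m n. 1 \<le> m \<and> 1 \<le> n \<and> G \<cong> cyclic_power m n)"

text \<open>The exponent is only meaningful for groups of bounded exponent, and the rank only for
  finitely generated groups; finite groups are both.\<close>

definition group_exponent :: "('a, 'b) monoid_scheme \<Rightarrow> nat" where
  "group_exponent G = (LEAST k. 0 < k \<and> (\<forall>x\<in>carrier G. x [^]\<^bsub>G\<^esub> k = \<one>\<^bsub>G\<^esub>))"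

definition group_rank :: "('a, 'b) monoid_scheme \<Rightarrow> nat" where
  "group_rank G = (LEAST k. \<exists>T. T \<subseteq> carrier G \<and> finite T \<and> card T = k \<and> generate G T = carrier G)"

definition edge_boundary :: "('a, 'b) monoid_scheme \<Rightarrow> 'a set \<Rightarrow> 'a set \<Rightarrow> nat" where
  "edge_boundary G S A = card {(a, s). a \<in> A \<and> s \<in> S \<and> a \<otimes>\<^bsub>G\<^esub> s \<notin> A}"

end

theory Submission
  imports Defs
begin

text \<open>Write \<open>m\<close> for the exponent. By induction on the generating set, every finite
  \<open>A \<subseteq> H = \<langle>S\<rangle>\<close> has edge boundary at least \<open>|A| log\<^sub>m (|H| / |A|)\<close>. Adjoining a generator \<open>s\<close>
  cuts \<open>A\<close> into slices along the \<open>d \<le> m\<close> cosets of the smaller subgroup, of sizes \<open>x\<^sub>i\<close>, and \<open>s\<close>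
  contributes at least the cyclic descent \<open>\<Sum> max(0, x\<^sub>i - x\<^sub>i\<^sub>+\<^sub>1)\<close>. What remains is an entropy
  inequality for \<open>x\<close>. Entropy is superadditive (log-sum inequality) and the descent is additive over
  level sets, so \<open>x\<close> may be taken to be the indicator function of \<open>k\<close> of the \<open>d\<close> cosets. That case
  is \<open>d\<^sup>k \<le> m k\<^sup>k\<close> for \<open>0 < k < d \<le> m\<close>, which holds because \<open>m \<le> 4\<close>.
  Since only \<open>d \<le> m\<close> is needed, no basis has to be extracted from \<open>S\<close>.\<close>

section \<open>The log-sum inequality and superadditivity of entropy\<close>

lemma log_sum_term_bound:
  fixes a b p q :: real
  assumes "0 \<le> a" "a \<le> p" "0 \<le> b" "b \<le> q" "0 < a + b"
  shows "a * (ln p - ln a - (ln (p + q) - ln (a + b))) \<le> p * (a + b) / (p + q) - a"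
proof (cases "a = 0")
  case True
  then show ?thesis using assms by simp
next
  case False
  then have pos: "a > 0" "p > 0" "p + q > 0" using assms by auto
  \<comment> \<open>\<open>t\<close> is the share p/(p+q) divided by the share a/(a+b). The tangent
    bound ln t <= t - 1 replaces the logarithms by a term that cancels on summation.\<close>
  define t where "t = p * (a + b) / (a * (p + q))"
  have "t > 0" using pos assms by (simp add: t_def)
  have "ln p - ln a - (ln (p + q) - ln (a + b)) = ln t"
    using pos assms by (simp add: t_def ln_div ln_mult)
  also have "\<dots> \<le> t - 1" using \<open>t > 0\<close> by (rule ln_le_minus_one)
  finally have "a * (ln p - ln a - (ln (p + q) - ln (a + b))) \<le> a * (t - 1)"
    using pos by (simp add: mult_left_mono)
  also have "\<dots> = p * (a + b) / (p + q) - a"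
    using pos by (simp add: t_def right_diff_distrib)
  finally show ?thesis .
qed

text \<open>Add the term bounds for (a, p) and (b, q): their right-hand sides sum to zero, because
  the shares of p and q in p + q add up to 1.\<close>

lemma log_sum_two:
  fixes a b p q :: real
  assumes "0 \<le> a" "a \<le> p" "0 \<le> b" "b \<le> q"
  shows "a * (ln p - ln a) + b * (ln q - ln b) \<le> (a + b) * (ln (p + q) - ln (a + b))"
proof (cases "a + b = 0")
  case True
  then have "a = 0" "b = 0" using assms by auto
  then show ?thesis by simp
next
  case False
  then have pos: "0 < a + b" "p + q > 0" using assms by auto
  have "a * (ln p - ln a - (ln (p + q) - ln (a + b))) \<le> p * (a + b) / (p + q) - a"
    using log_sum_term_bound[OF assms pos(1)] .
  moreover have "b * (ln q - ln b - (ln (p + q) - ln (a + b))) \<le> q * (a + b) / (p + q) - b"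
    using log_sum_term_bound[of b q a p] assms pos by (simp add: add.commute)
  moreover have "p * (a + b) / (p + q) + q * (a + b) / (p + q) = a + b"
    using pos by (simp add: add_divide_distrib[symmetric] distrib_right[symmetric])
  ultimately show ?thesis by (simp add: algebra_simps)
qed

text \<open>With N the sum of \<open>x\<close>, this is N times the Shannon entropy, in nats, of the
  distribution x i / N. Zero entries contribute 0, matching the convention 0 log 0 = 0.\<close>

definition unnormalized_entropy :: "'i set \<Rightarrow> ('i \<Rightarrow> nat) \<Rightarrow> real" where
  "unnormalized_entropy I x =
    real (sum x I) * ln (real (sum x I)) - (\<Sum>i\<in>I. real (x i) * ln (real (x i)))"

text \<open>Once the entropy is written as the sum of x i (ln N - ln (x i)),
  \<open>log_sum_two\<close> applies in each coordinate, with p and q the totals of \<open>x\<close>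
  and \<open>y\<close>.\<close>

lemma unnormalized_entropy_superadditive:
  assumes "finite I"
  shows "unnormalized_entropy I x + unnormalized_entropy I y
    \<le> unnormalized_entropy I (\<lambda>i. x i + y i)"
proof -
  have eq: "unnormalized_entropy I z =
      (\<Sum>i\<in>I. real (z i) * (ln (real (sum z I)) - ln (real (z i))))" for z
    by (simp add: unnormalized_entropy_def right_diff_distrib sum_subtractf sum_distrib_right)
  have "x i \<le> sum x I" "y i \<le> sum y I" if "i \<in> I" for i
    using assms that by (auto intro: member_le_sum)
  then have "(\<Sum>i\<in>I. real (x i) * (ln (real (sum x I)) - ln (real (x i)))
        + real (y i) * (ln (real (sum y I)) - ln (real (y i))))
      \<le> (\<Sum>i\<in>I. (real (x i) + real (y i)) *
           (ln (real (sum x I) + real (sum y I)) - ln (real (x i) + real (y i))))"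
    by (intro sum_mono log_sum_two) (auto simp del: of_nat_sum)
  then show ?thesis by (simp add: eq sum.distrib)
qed

section \<open>The entropy inequality for cyclic descents\<close>

lemma cyclic_exit:
  assumes "K \<subseteq> {..<d}" "K \<noteq> {}" "K \<noteq> {..<d}"
  obtains i where "i \<in> K" "Suc i mod d \<notin> K"
proof -
  have "K = {..<d}" if step: "\<And>i. i \<in> K \<Longrightarrow> Suc i mod d \<in> K"
  proof -
    obtain a where a: "a \<in> K" "a < d" using assms by auto
    have iter: "(a + j) mod d \<in> K" for j
    proof (induction j)
      case (Suc j)
      then show ?case using step[of "(a + j) mod d"] by (simp add: mod_Suc_eq)
    qed (use a in simp)
    \<comment> \<open>Adding \<open>d\<close> before subtracting \<open>a\<close> avoids truncation;
      modulo \<open>d\<close> the walk from \<open>a\<close> then ends at \<open>j\<close>.\<close>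
    have "j \<in> K" if "j < d" for j
      using iter[of "j + d - a"] a that by simp
    then show ?thesis using assms by auto
  qed
  then show ?thesis using assms that by blast
qed

text \<open>A finite check of d^k <= d k^k, and the place where the bound 4 enters: d = 4, k = 2
  gives equality, while d = 5, k = 2 would require 25 <= 20.\<close>

lemma level_set_bound:
  fixes k d m :: nat
  assumes "0 < k" "k < d" "d \<le> m" "d \<le> 4"
  shows "real k * ln (real d) \<le> real k * ln (real k) + ln (real m)"
proof -
  have "d = 2 \<or> d = 3 \<or> d = 4" and "k = 1 \<or> k = 2 \<or> k = 3" using assms by auto
  then have "d ^ k \<le> d * k ^ k" using assms by auto
  also have "\<dots> \<le> m * k ^ k" using assms by simp
  finally have "real d ^ k \<le> real m * real k ^ k"
    by (metis of_nat_le_iff of_nat_mult of_nat_power)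
  moreover have pos: "0 < real d" "0 < real m" "0 < real k" using assms by auto
  ultimately have "ln (real d ^ k) \<le> ln (real m * real k ^ k)"
    by (subst ln_le_cancel_iff) auto
  then show ?thesis using pos by (simp add: ln_mult ln_realpow)
qed

text \<open>Each induction step peels the bottom layer \<open>u\<close>, the indicator of the
  support, off \<open>x\<close> and leaves \<open>y\<close>. Truncated subtraction on nat supplies
  the positive part in the descent.\<close>

lemma cyclic_entropy_inequality:
  fixes x :: "nat \<Rightarrow> nat"
  assumes "0 < d" "d \<le> m" "d \<le> 4"
  shows "real (\<Sum>i<d. x i) * ln (real d) \<le> unnormalized_entropy {..<d} x
    + ln (real m) * real (\<Sum>i<d. x i - x (Suc i mod d))"
proof (induction "\<Sum>i<d. x i" arbitrary: x rule: less_induct)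
  case less
  show ?case
  proof (cases "\<Sum>i<d. x i")
    case 0
    then show ?thesis by (simp add: unnormalized_entropy_def)
  next
    case (Suc N)
    define K where "K = {i. i < d \<and> 0 < x i}"
    define y where "y = (\<lambda>i. x i - 1)"
    define u where "u = (\<lambda>i. if 0 < x i then 1 else 0 :: nat)"
    define k where "k = card K"
    have x_eq: "x = (\<lambda>i. y i + u i)" by (auto simp: y_def u_def)
    have "K \<subseteq> {..<d}" by (auto simp: K_def)
    then have finK: "finite K" by (rule finite_subset) simp
    have "K \<noteq> {}"
    proof
      assume "K = {}"
      then have "(\<Sum>i<d. x i) = 0" by (auto simp: K_def)
      then show False using Suc by simp
    qed
    then have "0 < k" using finK by (simp add: k_def card_gt_0_iff)
    have "(\<Sum>i<d. u i) = (\<Sum>i\<in>{..<d} \<inter> {i. 0 < x i}. 1)"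
      unfolding u_def by (subst sum.inter_restrict) auto
    also have "{..<d} \<inter> {i. 0 < x i} = K" by (auto simp: K_def)
    finally have sum_u: "(\<Sum>i<d. u i) = k" by (simp add: k_def)
    have sum_x: "(\<Sum>i<d. x i) = (\<Sum>i<d. y i) + k"
      by (subst x_eq) (simp add: sum.distrib sum_u)
    have IH: "real (\<Sum>i<d. y i) * ln (real d) \<le> unnormalized_entropy {..<d} y
        + ln (real m) * real (\<Sum>i<d. y i - y (Suc i mod d))"
      using less sum_x \<open>0 < k\<close> by simp
    have "(\<Sum>i<d. real (u i) * ln (real (u i))) = 0"
      by (intro sum.neutral) (simp add: u_def)
    then have ent_u: "unnormalized_entropy {..<d} u = real k * ln (real k)"
      using sum_u by (simp add: unnormalized_entropy_def flip: of_nat_sum)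
    have ent: "unnormalized_entropy {..<d} y + real k * ln (real k) \<le> unnormalized_entropy {..<d} x"
      using unnormalized_entropy_superadditive[of "{..<d}" y u]
      by (simp add: ent_u flip: x_eq)
    \<comment> \<open>Exact despite truncation: the layers are nested, so the differences in
      \<open>y\<close> and in \<open>u\<close> never have opposite signs.\<close>
    have "x i - x j = (y i - y j) + (u i - u j)" for i j
      by (simp add: y_def u_def)
    then have diff: "(\<Sum>i<d. x i - x (Suc i mod d)) =
        (\<Sum>i<d. y i - y (Suc i mod d)) + (\<Sum>i<d. u i - u (Suc i mod d))"
      by (simp add: sum.distrib)
    have "real k * ln (real d) \<le> real k * ln (real k)
        + ln (real m) * real (\<Sum>i<d. u i - u (Suc i mod d))"
    \<comment> \<open>A full layer has k = d, which settles the claim without any descent. Any other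
      layer has a cyclic exit, and this one unit of descent pays the ln m in
      \<open>level_set_bound\<close>.\<close>
    proof (cases "K = {..<d}")
      case True
      then have "k = d" by (simp add: k_def)
      then show ?thesis using assms by (simp add: sum_nonneg)
    next
      case False
      then obtain i where i: "i \<in> K" "Suc i mod d \<notin> K"
        using cyclic_exit[OF \<open>K \<subseteq> {..<d}\<close> \<open>K \<noteq> {}\<close>] by blast
      have "k < d" using False \<open>K \<subseteq> {..<d}\<close>
        by (metis card_lessThan finite_lessThan k_def psubsetI psubset_card_mono)
      have "1 = u i - u (Suc i mod d)"
        using i assms by (auto simp: u_def K_def)
      also have "\<dots> \<le> (\<Sum>i<d. u i - u (Suc i mod d))"
        using i \<open>K \<subseteq> {..<d}\<close> by (intro member_le_sum) auto
      finally have "ln (real m) * 1 \<le> ln (real m) * real (\<Sum>i<d. u i - u (Suc i mod d))"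
        using assms by (intro mult_left_mono) (simp_all flip: of_nat_sum)
      then show ?thesis
        using level_set_bound[OF \<open>0 < k\<close> \<open>k < d\<close> assms(2,3)] by linarith
    qed
    then show ?thesis
      using IH ent by (simp add: sum_x diff algebra_simps)
  qed
qed

section \<open>Coset slicing and the edge-isoperimetric inequality\<close>

lemma (in comm_group) power_coset_decomposition:
  fixes m :: nat
  assumes S: "S \<subseteq> carrier G" and s: "s \<in> carrier G"
    and m: "0 < m" "s [^] m = \<one>"
  obtains d :: nat where "0 < d" "d \<le> m" "s [^] d \<in> generate G S"
    "bij_betw (\<lambda>(i, h). s [^] i \<otimes> h) ({..<d} \<times> generate G S) (generate G (insert s S))"
proof -
  define H where "H = generate G S"
  have sub: "subgroup H G" using S by (simp add: H_def generate_is_subgroup)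
  interpret H: subgroup H G by (rule sub)
  have HG: "h \<in> carrier G" if "h \<in> H" for h using H.subset that by auto
  \<comment> \<open>\<open>d\<close> is the order of \<open>s\<close> modulo \<open>H\<close>.
    Minimality makes the cosets of the powers below \<open>d\<close> distinct, and s^m = 1 gives d
    <= m.\<close>
  define d where "d = (LEAST k::nat. 0 < k \<and> s [^] k \<in> H)"
  have "0 < m \<and> s [^] m \<in> H" using m by simp
  then have d: "0 < d" "s [^] d \<in> H" "d \<le> m"
    unfolding d_def by (metis (mono_tags, lifting) LeastI, metis (mono_tags, lifting) LeastI, rule Least_le)
  have min: "s [^] k \<notin> H" if "0 < k" "k < d" for k :: nat
    using that not_less_Least unfolding d_def by blast
  let ?f = "\<lambda>(i::nat, h). s [^] i \<otimes> h"
  have sH: "s [^] (j - i) \<in> H"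
    if "i < j" "h \<in> H" "h' \<in> H" "s [^] i \<otimes> h = s [^] j \<otimes> h'" for i j :: nat and h h'
  proof -
    have "s [^] i \<otimes> h = s [^] i \<otimes> (s [^] (j - i) \<otimes> h')"
      using that s HG by (simp add: nat_pow_mult flip: m_assoc)
    then have "h = s [^] (j - i) \<otimes> h'" using that s HG by simp
    then have "s [^] (j - i) = h \<otimes> inv h'" using that s HG by (simp add: inv_solve_right)
    then show ?thesis using that by simp
  qed
  have inj: "inj_on ?f ({..<d} \<times> H)"
  proof (rule inj_onI, clarify)
    fix i j :: nat and h h'
    assume a: "i < d" "j < d" "h \<in> H" "h' \<in> H" "s [^] i \<otimes> h = s [^] j \<otimes> h'"
    have "\<not> i < j" using sH[of i j h h'] min[of "j - i"] a by auto
    moreover have "\<not> j < i" using sH[of j i h' h] min[of "i - j"] a by auto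
    ultimately have "i = j" by simp
    then show "i = j \<and> h = h'" using a s HG by simp
  qed
  define K where "K = {s [^] i \<otimes> h | (i::nat) h. h \<in> H}"
  have K_eq: "K = ?f ` ({..<d} \<times> H)"
  proof
    show "?f ` ({..<d} \<times> H) \<subseteq> K" by (auto simp: K_def)
    show "K \<subseteq> ?f ` ({..<d} \<times> H)"
    proof
      fix x assume "x \<in> K"
      then obtain i :: nat and h where x: "x = s [^] i \<otimes> h" "h \<in> H" by (auto simp: K_def)
      \<comment> \<open>Division with remainder: the multiple of \<open>d\<close> in the exponent is
        absorbed into \<open>H\<close>.\<close>
      have "s [^] i = s [^] (i mod d + d * (i div d))" by simp
      also have "\<dots> = s [^] (i mod d) \<otimes> (s [^] d) [^] (i div d)"
        using s by (simp add: nat_pow_mult nat_pow_pow del: mod_mult_div_eq)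
      finally have "x = s [^] (i mod d) \<otimes> ((s [^] d) [^] (i div d) \<otimes> h)"
        using x s HG by (simp add: m_assoc)
      moreover have "(s [^] d) [^] q \<in> H" for q :: nat
        by (induction q) (use d in auto)
      ultimately show "x \<in> ?f ` ({..<d} \<times> H)"
        using x d by (intro image_eqI[of _ _ "(i mod d, (s [^] d) [^] (i div d) \<otimes> h)"]) auto
    qed
  qed
  have "subgroup K G"
  proof (rule subgroupI)
    show "K \<subseteq> carrier G" using s HG by (auto simp: K_def)
    show "K \<noteq> {}" using H.one_closed unfolding K_def by blast
  next
    fix x assume "x \<in> K"
    then obtain i :: nat and h where x: "x = s [^] i \<otimes> h" "h \<in> H" by (auto simp: K_def)
    \<comment> \<open>Since s^m = 1, inverses of powers of \<open>s\<close> are again powers with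
      natural exponents.\<close>
    have "s [^] ((m - 1) * i) \<otimes> s [^] i = s [^] (m * i)"
      using s m by (simp add: nat_pow_mult diff_mult_distrib)
    also have "\<dots> = \<one>" using s m by (simp flip: nat_pow_pow)
    finally have "inv (s [^] i) = s [^] ((m - 1) * i)" using s by (intro inv_equality) auto
    then have "inv x = s [^] ((m - 1) * i) \<otimes> inv h" using x s HG by (simp add: inv_mult)
    then show "inv x \<in> K" using x by (auto simp: K_def)
  next
    fix x y assume "x \<in> K" "y \<in> K"
    then obtain i j :: nat and h h'
      where x: "x = s [^] i \<otimes> h" "h \<in> H" and y: "y = s [^] j \<otimes> h'" "h' \<in> H"
      by (auto simp: K_def)
    have "x \<otimes> y = (s [^] i \<otimes> s [^] j) \<otimes> (h \<otimes> h')"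
      using x y s HG by (simp add: m_ac)
    then have "x \<otimes> y = s [^] (i + j) \<otimes> (h \<otimes> h')" using s by (simp add: nat_pow_mult)
    then show "x \<otimes> y \<in> K" using x y by (auto simp: K_def)
  qed
  moreover have "insert s S \<subseteq> K"
  proof -
    have "s = s [^] (1::nat) \<otimes> \<one>" using s by simp
    then have "s \<in> K" using H.one_closed unfolding K_def by blast
    moreover have "x \<in> K" if "x \<in> S" for x
    proof -
      have "x = s [^] (0::nat) \<otimes> x" "x \<in> H" using S that by (auto simp: H_def generate.incl)
      then show ?thesis unfolding K_def by blast
    qed
    ultimately show ?thesis by auto
  qed
  ultimately have "generate G (insert s S) \<subseteq> K" by (rule generate_subgroup_incl[rotated])
  moreover have "K \<subseteq> generate G (insert s S)"
  proof -
    interpret L: subgroup "generate G (insert s S)" G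
      using s S by (simp add: generate_is_subgroup)
    have "s [^] i \<in> generate G (insert s S)" for i :: nat
      by (induction i) (auto simp: generate.incl)
    moreover have "H \<subseteq> generate G (insert s S)" unfolding H_def by (intro mono_generate) auto
    ultimately show ?thesis by (auto simp: K_def)
  qed
  ultimately show thesis
    using that[of d] d inj K_eq by (simp add: bij_betw_def H_def)
qed

lemma edge_boundary_eq_sum:
  assumes "finite A" "finite S"
  shows "edge_boundary G S A = (\<Sum>s\<in>S. card {a \<in> A. a \<otimes>\<^bsub>G\<^esub> s \<notin> A})"
proof -
  have "edge_boundary G S A = card (SIGMA s:S. {a \<in> A. a \<otimes>\<^bsub>G\<^esub> s \<notin> A})"
    unfolding edge_boundary_def
    by (rule bij_betw_same_card[of prod.swap], rule bij_betw_byWitness[of _ prod.swap]) auto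
  then show ?thesis using assms by simp
qed

text \<open>Taking \<open>A\<close> inside the generated subgroup lets the induction on
  \<open>S\<close> apply to coset slices. With natural logarithms, the base \<open>m\<close> becomes
  the factor ln m on the right.\<close>

lemma (in comm_group) edge_isoperimetric:
  fixes m :: nat
  assumes fin: "finite (carrier G)" and m: "0 < m" "m \<le> 4"
    and pow: "\<And>x. x \<in> carrier G \<Longrightarrow> x [^] m = \<one>"
    and S: "S \<subseteq> carrier G" and A: "A \<subseteq> generate G S"
  shows "real (card A) * (ln (real (card (generate G S))) - ln (real (card A)))
    \<le> ln (real m) * real (edge_boundary G S A)"
proof -
  have "finite S" using S fin by (rule finite_subset)
  then show ?thesis using S A
  proof (induction S arbitrary: A rule: finite_induct)
    case empty
    then have "card A \<le> card {\<one>}"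
      by (intro card_mono) (simp_all add: generate_empty)
    then have "card A = 0 \<or> card A = 1" by auto
    then show ?case using m by (auto simp: generate_empty)
  next
    case (insert s S)
    have s: "s \<in> carrier G" and SG: "S \<subseteq> carrier G" using insert.prems by auto
    define H where "H = generate G S"
    interpret H: subgroup H G using SG by (simp add: H_def generate_is_subgroup)
    have HG: "h \<in> carrier G" if "h \<in> H" for h using H.subset that by auto
    have finH: "finite H" using H.subset fin by (rule finite_subset)
    \<comment> \<open>A redundant generator, with \<open>s\<close> already in \<open>H\<close>, is
      covered as d = 1.\<close>
    obtain d :: nat where d: "0 < d" "d \<le> m" "s [^] d \<in> H"
      and bij: "bij_betw (\<lambda>(i, h). s [^] i \<otimes> h) ({..<d} \<times> H) (generate G (insert s S))"
      by (rule power_coset_decomposition[OF SG s m(1) pow[OF s], folded H_def])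
    \<comment> \<open>Each slice is translated back into \<open>H\<close>, where the induction
      hypothesis applies to it.\<close>
    define slice where "slice i = {h \<in> H. s [^] i \<otimes> h \<in> A}" for i :: nat
    define x where "x i = card (slice i)" for i
    have fin_slice: "finite (slice i)" for i using finH by (simp add: slice_def)
    have finA: "finite A"
      using insert.prems fin generate_incl[of "insert s S"] by (blast intro: finite_subset)
    have card_slices: "card {a \<in> A. P a} = (\<Sum>i<d. card {h \<in> slice i. P (s [^] i \<otimes> h)})" for P
    proof -
      let ?D = "SIGMA i:{..<d}. {h \<in> slice i. P (s [^] i \<otimes> h)}"
      have "bij_betw (\<lambda>(i, h). s [^] i \<otimes> h) ?D {a \<in> A. P a}"
      proof (rule bij_betw_subset[OF bij])
        show "?D \<subseteq> {..<d} \<times> H" by (auto simp: slice_def)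
        show "(\<lambda>(i, h). s [^] i \<otimes> h) ` ?D = {a \<in> A. P a}"
        proof
          show "{a \<in> A. P a} \<subseteq> (\<lambda>(i, h). s [^] i \<otimes> h) ` ?D"
          proof
            fix a assume a: "a \<in> {a \<in> A. P a}"
            then have "a \<in> (\<lambda>(i, h). s [^] i \<otimes> h) ` ({..<d} \<times> H)"
              using insert.prems bij by (auto simp: bij_betw_def)
            then show "a \<in> (\<lambda>(i, h). s [^] i \<otimes> h) ` ?D" using a by (auto simp: slice_def)
          qed
        qed (auto simp: slice_def)
      qed
      then have "card {a \<in> A. P a} = card ?D" by (rule bij_betw_same_card[symmetric])
      then show ?thesis using fin_slice by simp
    qed
    have cardA: "card A = (\<Sum>i<d. x i)"
      using card_slices[of "\<lambda>_. True"] by (simp add: x_def)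
    have cardL: "card (generate G (insert s S)) = d * card H"
      using bij_betw_same_card[OF bij] by (simp add: card_cartesian_product)
    \<comment> \<open>Translation by an element of \<open>S\<close> preserves every coset of
      \<open>H\<close>, so these edges never connect different slices.\<close>
    have boundary_S: "edge_boundary G S A = (\<Sum>i<d. edge_boundary G S (slice i))"
    proof -
      have "card {a \<in> A. a \<otimes> t \<notin> A} = (\<Sum>i<d. card {h \<in> slice i. h \<otimes> t \<notin> slice i})"
        if "t \<in> S" for t
      proof -
        have t: "t \<in> H" using that by (simp add: H_def generate.incl)
        have "{h \<in> slice i. s [^] i \<otimes> h \<otimes> t \<notin> A} = {h \<in> slice i. h \<otimes> t \<notin> slice i}" for i
          using t s HG by (auto simp: slice_def m_assoc)
        then show ?thesis by (simp add: card_slices)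
      qed
      then show ?thesis
        using finA fin_slice insert.hyps by (simp add: edge_boundary_eq_sum sum.swap[of _ "{..<d}"])
    qed
    have "x i - x (Suc i mod d) \<le> card {h \<in> slice i. s [^] i \<otimes> h \<otimes> s \<notin> A}"
      if i: "i < d" for i
    proof -
      \<comment> \<open>Multiplication by \<open>s\<close> takes coset i to the next one, shifting
        by \<open>g\<close>: this is s^d at the wrap-around and 1 elsewhere.\<close>
      obtain g where g: "g \<in> H" "s [^] Suc i = s [^] (Suc i mod d) \<otimes> g"
      proof (cases "Suc i = d")
        case True
        show thesis by (rule that[of "s [^] d"]) (use True d s in simp_all)
      next
        case False
        then have "Suc i mod d = Suc i" using i by simp
        then show thesis using s by (intro that[of \<one>]) simp_all
      qed
      have step: "s [^] i \<otimes> h \<otimes> s = s [^] (Suc i mod d) \<otimes> (g \<otimes> h)" if "h \<in> H" for h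
      proof -
        have "s [^] i \<otimes> h \<otimes> s = (s [^] i \<otimes> s) \<otimes> h" using s HG that by (simp add: m_ac)
        also have "s [^] i \<otimes> s = s [^] (Suc i mod d) \<otimes> g" using g by simp
        finally show ?thesis using s HG that g by (simp add: m_assoc)
      qed
      let ?E = "{h \<in> slice i. s [^] i \<otimes> h \<otimes> s \<notin> A}"
      \<comment> \<open>Elements that \<open>s\<close> keeps inside \<open>A\<close> inject into the
        next slice, so the excess of slice i over it must leave \<open>A\<close>.\<close>
      have image: "(\<lambda>h. g \<otimes> h) ` (slice i - ?E) \<subseteq> slice (Suc i mod d)"
      proof
        fix y assume "y \<in> (\<lambda>h. g \<otimes> h) ` (slice i - ?E)"
        then obtain h where h: "h \<in> H" "s [^] i \<otimes> h \<otimes> s \<in> A" "y = g \<otimes> h"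
          unfolding slice_def by blast
        then show "y \<in> slice (Suc i mod d)"
          using g step[OF h(1)] by (simp add: slice_def)
      qed
      have inj: "inj_on (\<lambda>h. g \<otimes> h) (slice i - ?E)"
        using g HG by (auto simp: inj_on_def slice_def)
      have "card (slice i - ?E) \<le> x (Suc i mod d)"
        unfolding x_def by (rule card_inj_on_le[OF inj image fin_slice])
      moreover have "card (slice i - ?E) = x i - card ?E"
        unfolding x_def using fin_slice by (intro card_Diff_subset) auto
      ultimately show ?thesis by linarith
    qed
    then have "(\<Sum>i<d. x i - x (Suc i mod d)) \<le> card {a \<in> A. a \<otimes> s \<notin> A}"
      unfolding card_slices[of "\<lambda>a. a \<otimes> s \<notin> A"] by (intro sum_mono) auto
    moreover have "edge_boundary G (insert s S) A
        = card {a \<in> A. a \<otimes> s \<notin> A} + edge_boundary G S A"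
      using insert.hyps finA by (simp add: edge_boundary_eq_sum)
    ultimately have boundary: "edge_boundary G (insert s S) A \<ge>
        (\<Sum>i<d. x i - x (Suc i mod d)) + (\<Sum>i<d. edge_boundary G S (slice i))"
      using boundary_S by simp
    have "(\<Sum>i<d. real (x i) * (ln (real (card H)) - ln (real (x i))))
        \<le> (\<Sum>i<d. ln (real m) * real (edge_boundary G S (slice i)))"
      using insert.IH[OF SG] unfolding x_def H_def
      by (intro sum_mono) (simp add: slice_def H_def)
    then have "real (card A) * ln (real (card H)) - (\<Sum>i<d. real (x i) * ln (real (x i)))
        \<le> ln (real m) * real (\<Sum>i<d. edge_boundary G S (slice i))"
      by (simp add: cardA right_diff_distrib sum_subtractf sum_distrib_left sum_distrib_right)
    \<comment> \<open>The descent along \<open>s\<close> pays for the term |A| ln d, by which the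
      bound for the larger subgroup exceeds the one for \<open>H\<close>.\<close>
    moreover have "real (card A) * ln (real d) \<le> real (card A) * ln (real (card A))
        - (\<Sum>i<d. real (x i) * ln (real (x i)))
        + ln (real m) * real (\<Sum>i<d. x i - x (Suc i mod d))"
      using cyclic_entropy_inequality[of d m x] d m
      by (simp add: unnormalized_entropy_def cardA)
    moreover have "ln (real (card (generate G (insert s S)))) = ln (real d) + ln (real (card H))"
      using d finH H.one_closed by (auto simp: cardL ln_mult card_gt_0_iff)
    ultimately have "real (card A) * (ln (real (card (generate G (insert s S)))) - ln (real (card A)))
        \<le> ln (real m) * real ((\<Sum>i<d. x i - x (Suc i mod d)) + (\<Sum>i<d. edge_boundary G S (slice i)))"
      by (simp add: algebra_simps)
    also have "\<dots> \<le> ln (real m) * real (edge_boundary G (insert s S) A)"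
      using boundary m by (intro mult_left_mono) (simp_all only: of_nat_le_iff, simp)
    finally show ?case .
  qed
qed

section \<open>Order, exponent and rank of homocyclic groups\<close>

lemma nat_pow_product_group:
  fixes k :: nat
  assumes "\<And>i. i \<in> I \<Longrightarrow> group (G i)" and "f \<in> carrier (product_group I G)"
  shows "f [^]\<^bsub>product_group I G\<^esub> k = (\<lambda>i\<in>I. f i [^]\<^bsub>G i\<^esub> k)"
proof -
  interpret P: group "product_group I G" using assms(1) by simp
  show ?thesis
  proof (induction k)
    case 0
    show ?case by (simp add: nat_pow_def)
  next
    case (Suc k)
    have "f [^]\<^bsub>product_group I G\<^esub> Suc k =
        (\<lambda>i\<in>I. (f i [^]\<^bsub>G i\<^esub> k) \<otimes>\<^bsub>G i\<^esub> f i)"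
      unfolding P.nat_pow_Suc Suc mult_product_group by (intro restrict_ext) simp
    also have "\<dots> = (\<lambda>i\<in>I. f i [^]\<^bsub>G i\<^esub> Suc k)"
      unfolding nat_pow_def by (intro restrict_ext) simp
    finally show ?case .
  qed
qed

lemma group_cyclic_power [simp]: "group (cyclic_power m n)"
  by (simp add: cyclic_power_def)

lemma nat_pow_cyclic_power:
  fixes k :: nat
  assumes "f \<in> carrier (cyclic_power m n)"
  shows "f [^]\<^bsub>cyclic_power m n\<^esub> k = (\<lambda>i\<in>{..<n}. int k * f i mod int m)"
  using assms nat_pow_product_group[of "{..<n}" "\<lambda>_. integer_mod_group m" f k]
  by (simp add: cyclic_power_def)

lemma order_cyclic_power: "0 < m \<Longrightarrow> order (cyclic_power m n) = m ^ n"
  by (simp add: order_def cyclic_power_def carrier_integer_mod_group card_PiE)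

lemma generators_cyclic_power:
  assumes "0 < m"
  obtains T where "T \<subseteq> carrier (cyclic_power m n)" "finite T" "card T \<le> n"
    "generate (cyclic_power m n) T = carrier (cyclic_power m n)"
proof
  let ?P = "cyclic_power m n"
  \<comment> \<open>Standard unit vectors. Reducing 1 modulo \<open>m\<close> keeps them in the
    carrier for m = 1, where they all coincide; hence only card T <= n is claimed.\<close>
  define e where "e j = (\<lambda>i\<in>{..<n}. if i = j then 1 mod int m else 0)" for j
  let ?T = "e ` {..<n}"
  interpret P: group ?P by simp
  have e: "e j \<in> carrier ?P" for j
    using assms by (auto simp: e_def cyclic_power_def carrier_integer_mod_group)
  show T: "?T \<subseteq> carrier ?P" using e by auto
  show "finite ?T" "card ?T \<le> n" using card_image_le[of "{..<n}" e] by auto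
  interpret H: subgroup "generate ?P ?T" ?P using T by (rule P.generate_is_subgroup)
  show "generate ?P ?T = carrier ?P"
  proof
    show "generate ?P ?T \<subseteq> carrier ?P" by (rule H.subset)
    show "carrier ?P \<subseteq> generate ?P ?T"
    proof
      fix f assume f: "f \<in> carrier ?P"
      then have range: "0 \<le> f i" "f i < int m" if "i < n" for i
        using assms that by (auto simp: cyclic_power_def carrier_integer_mod_group PiE_iff)
      \<comment> \<open>\<open>f\<close> is assembled one coordinate at a time: passing from
        \<open>j\<close> to \<open>Suc j\<close> adds f j copies of \<open>e j\<close>.\<close>
      define trunc where "trunc j = (\<lambda>i\<in>{..<n}. if i < j then f i else 0)" for j
      have "trunc j \<in> generate ?P ?T" if "j \<le> n" for j
        using that
      proof (induction j)
        case 0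
        have "trunc 0 = \<one>\<^bsub>?P\<^esub>" by (simp add: trunc_def cyclic_power_def)
        then show ?case by simp
      next
        case (Suc j)
        have gen: "e j [^]\<^bsub>?P\<^esub> k \<in> generate ?P ?T" for k :: nat
        proof (induction k)
          case (Suc k)
          have "e j \<in> generate ?P ?T" using \<open>Suc j \<le> n\<close> by (intro generate.incl) auto
          then show ?case using Suc by simp
        qed simp
        have "e j [^]\<^bsub>?P\<^esub> nat (f j) = (\<lambda>i\<in>{..<n}. if i = j then f j else 0)"
          unfolding nat_pow_cyclic_power[OF e]
          using range Suc.prems by (auto simp: e_def fun_eq_iff mod_mult_right_eq)
        then have "trunc (Suc j) = trunc j \<otimes>\<^bsub>?P\<^esub> e j [^]\<^bsub>?P\<^esub> nat (f j)"
          using range by (auto simp: trunc_def cyclic_power_def fun_eq_iff less_Suc_eq)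
        then show ?case using Suc gen by simp
      qed
      then have "trunc n \<in> generate ?P ?T" by simp
      moreover have "trunc n = f"
        using f by (auto simp: trunc_def cyclic_power_def PiE_iff extensional_def fun_eq_iff)
      ultimately show "f \<in> generate ?P ?T" by simp
    qed
  qed
qed

lemma group_rank_le:
  assumes "T \<subseteq> carrier G" "finite T" "generate G T = carrier G"
  shows "group_rank G \<le> card T"
  unfolding group_rank_def using assms by (intro Least_le) blast

text \<open>For G isomorphic to C_m^n, the exponent is at most \<open>m\<close> because
  \<open>m\<close> annihilates G, and the rank is at most \<open>n\<close> because the images of the
  unit vectors generate G. The order is m^n.\<close>

lemma homocyclic_order_exponent:
  assumes "homocyclic G"
  shows "finite (carrier G)" and "group_exponent G ^ group_rank G \<le> order G"
    and "x \<in> carrier G \<Longrightarrow> x [^]\<^bsub>G\<^esub> group_exponent G = \<one>\<^bsub>G\<^esub>"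
proof -
  obtain m n where "comm_group G" and m: "1 \<le> m" and iso: "G \<cong> cyclic_power m n"
    using assms by (auto simp: homocyclic_def)
  let ?P = "cyclic_power m n"
  interpret G: comm_group G by fact
  interpret P: group ?P by simp
  obtain \<phi> where \<phi>: "\<phi> \<in> iso ?P G"
    using G.iso_sym[OF iso] by (auto simp: is_iso_def)
  then have bij: "bij_betw \<phi> (carrier ?P) (carrier G)" by (simp add: iso_def)
  interpret \<phi>: group_hom ?P G \<phi>
    using \<phi> by unfold_locales (simp add: iso_def)
  have order: "order G = m ^ n"
    using bij_betw_same_card[OF bij] order_cyclic_power[of m n] m by (simp add: order_def)
  show fin: "finite (carrier G)"
    using order m by (intro card_ge_0_finite) (simp add: order_def)
  have "x [^]\<^bsub>G\<^esub> m = \<one>\<^bsub>G\<^esub>" if "x \<in> carrier G" for x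
  proof -
    have "x \<in> \<phi> ` carrier ?P" using that by (simp only: bij_betw_imp_surj_on[OF bij])
    then obtain f where f: "f \<in> carrier ?P" "x = \<phi> f" by (elim imageE)
    have "f [^]\<^bsub>?P\<^esub> m = \<one>\<^bsub>?P\<^esub>"
      using f by (simp add: nat_pow_cyclic_power) (simp add: cyclic_power_def)
    then have "\<phi> (f [^]\<^bsub>?P\<^esub> m) = \<one>\<^bsub>G\<^esub>" by (simp only: \<phi>.hom_one)
    then show ?thesis using f by (simp only: \<phi>.hom_nat_pow)
  qed
  then have expo: "0 < m \<and> (\<forall>x\<in>carrier G. x [^]\<^bsub>G\<^esub> m = \<one>\<^bsub>G\<^esub>)" using m by simp
  then have e: "0 < group_exponent G \<and> (\<forall>x\<in>carrier G. x [^]\<^bsub>G\<^esub> group_exponent G = \<one>\<^bsub>G\<^esub>)"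
    unfolding group_exponent_def by (rule LeastI)
  then show "x \<in> carrier G \<Longrightarrow> x [^]\<^bsub>G\<^esub> group_exponent G = \<one>\<^bsub>G\<^esub>" by auto
  have em: "group_exponent G \<le> m"
    unfolding group_exponent_def using expo by (rule Least_le)
  obtain T where T: "T \<subseteq> carrier ?P" "finite T" "card T \<le> n" "generate ?P T = carrier ?P"
    by (rule generators_cyclic_power[of m n]) (use m in auto)
  have "generate G (\<phi> ` T) = carrier G"
    using \<phi>.generate_img[OF T(1)] T(4) bij by (simp add: bij_betw_def)
  then have "group_rank G \<le> card (\<phi> ` T)" using T by (intro group_rank_le) auto
  also have "\<dots> \<le> n" using card_image_le[OF T(2), of \<phi>] T(3) by simp
  finally have "group_exponent G ^ group_rank G \<le> group_exponent G ^ n"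
    using e by (intro power_increasing) auto
  also have "\<dots> \<le> m ^ n" using em by (intro power_mono) auto
  finally show "group_exponent G ^ group_rank G \<le> order G" by (simp add: order)
qed

theorem theorem1p1:
  fixes G :: "('a, 'b) monoid_scheme" and A S :: "'a set" and n :: nat and \<gamma> :: real
  assumes "homocyclic G"
    and "group_exponent G \<in> {2, 3, 4}"
    and "n = group_rank G"
    and "A \<subseteq> carrier G" and "A \<noteq> {}"
    and "S \<subseteq> carrier G" and "generate G S = carrier G"
    and "0 < \<gamma>" and "\<gamma> \<le> 1"
    and "real (edge_boundary G S A) \<le> (1 - \<gamma>) * real n * real (card A)"
  shows "real (card A) \<ge> real (order G) powr \<gamma>"
proof -
  interpret G: comm_group G using assms(1) by (simp add: homocyclic_def)
  define m where "m = group_exponent G"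
  have m: "0 < m" "m \<le> 4" using assms(2) by (auto simp: m_def)
  have fin: "finite (carrier G)" by (rule homocyclic_order_exponent(1)[OF assms(1)])
  have cardA: "0 < real (card A)"
    using finite_subset[OF assms(4) fin] assms(5) by (simp add: card_gt_0_iff)
  have order_pos: "0 < real (order G)" using fin by (simp add: G.order_gt_0_iff_finite)
  \<comment> \<open>In logarithmic form this turns the factor n ln m, arising from the boundary
    hypothesis, into ln |G|.\<close>
  have "real (m ^ n) \<le> real (order G)"
    using homocyclic_order_exponent(2)[OF assms(1)] by (simp only: m_def assms(3) of_nat_le_iff)
  then have "ln (real m ^ n) \<le> ln (real (order G))"
    using m order_pos by (subst ln_le_cancel_iff) auto
  then have nm: "real n * ln (real m) \<le> ln (real (order G))"
    using m by (simp add: ln_realpow)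
  have "real (card A) * (ln (real (order G)) - ln (real (card A)))
      \<le> ln (real m) * real (edge_boundary G S A)"
    using G.edge_isoperimetric[OF fin m, of S A] homocyclic_order_exponent(3)[OF assms(1)] assms
    by (simp add: m_def order_def)
  also have "\<dots> \<le> ln (real m) * ((1 - \<gamma>) * real n * real (card A))"
    using assms m by (intro mult_left_mono) auto
  also have "\<dots> = real (card A) * ((1 - \<gamma>) * (real n * ln (real m)))" by simp
  \<comment> \<open>Here \<gamma> <= 1 keeps the factor 1 - \<gamma> nonnegative. Cancelling |A| > 0
    then leaves the claim in logarithmic form.\<close>
  also have "\<dots> \<le> real (card A) * ((1 - \<gamma>) * ln (real (order G)))"
    using nm assms by (intro mult_left_mono) auto
  finally have "ln (real (order G)) - ln (real (card A)) \<le> (1 - \<gamma>) * ln (real (order G))"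
    using cardA by simp
  then have "\<gamma> * ln (real (order G)) \<le> ln (real (card A))" by (simp add: algebra_simps)
  then have "exp (\<gamma> * ln (real (order G))) \<le> exp (ln (real (card A)))" by simp
  then show ?thesis using cardA order_pos by (simp add: powr_def)
qed

end
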